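(* Let $k\ge 2$ and let $G$ be a bridgeless graph with girth at least $2k-1$. If $G$ is $2$-simultaneous edge colorable, then $|E(G)|\ge k\,\chi'(G)$.
   Context: All graphs are finite and simple; $[l]=\{1,\ldots,l\}$. "Bridgeless" means $2$-edge-connected. $\chi'(G)$ is the edge chromatic number. A $2$-simultaneous edge coloring of $G$ is a pair $(c_1,c_2)$ of proper edge colorings $c_i:E(G)\to[l]$ with a common color set such that for every vertex $v$ the sets of colors on edges incident to $v$ are the same under $c_1$ and $c_2$, and $c_1(e)\ne c_2(e)$ for every edge $e$; $G$ is $2$-simultaneous edge colorable if such a pair exists for some $l$. *)

theory Defs
  imports Main "HOL-Library.Extended_Nat"
begin

text \<open>A graph is given by a vertex set \<open>V\<close> and a set \<open>E\<close> of edges, each edge being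
  the two-element set of its endpoints.\<close>

definition simple_graph :: "'a set \<Rightarrow> 'a set set \<Rightarrow> bool" where
  "simple_graph V E \<longleftrightarrow> finite V \<and> (\<forall>e\<in>E. e \<subseteq> V \<and> card e = 2)"

definition connected_graph :: "'a set \<Rightarrow> 'a set set \<Rightarrow> bool" where
  "connected_graph V E \<longleftrightarrow>
     V \<noteq> {} \<and> (\<forall>u\<in>V. \<forall>v\<in>V. (u, v) \<in> {(x, y). {x, y} \<in> E}\<^sup>*)"

text \<open>``Bridgeless'' includes connectedness: it means 2-edge-connected.  The graph with a
  single vertex is admitted.\<close>

definition bridgeless :: "'a set \<Rightarrow> 'a set set \<Rightarrow> bool" where
  "bridgeless V E \<longleftrightarrow>
     connected_graph V E \<and> (\<forall>e\<in>E. connected_graph V (E - {e}))"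

text \<open>A cycle is the list of its pairwise distinct vertices in cyclic order; the first vertex
  is not repeated at the end, so the length of the list is the length of the cycle.\<close>

definition is_cycle :: "'a set set \<Rightarrow> 'a list \<Rightarrow> bool" where
  "is_cycle E p \<longleftrightarrow>
     3 \<le> length p \<and> distinct p \<and>
     (\<forall>i<length p. {p ! i, p ! (Suc i mod length p)} \<in> E)"

text \<open>The girth of an acyclic graph is \<open>\<infinity>\<close>, the infimum of the empty set.\<close>

definition girth :: "'a set set \<Rightarrow> enat" where
  "girth E = Inf {enat (length p) | p. is_cycle E p}"

definition proper_edge_coloring :: "'a set set \<Rightarrow> nat \<Rightarrow> ('a set \<Rightarrow> nat) \<Rightarrow> bool" where
  "proper_edge_coloring E l c \<longleftrightarrow>
     c ` E \<subseteq> {1..l} \<and>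
     (\<forall>e\<in>E. \<forall>f\<in>E. e \<noteq> f \<and> e \<inter> f \<noteq> {} \<longrightarrow> c e \<noteq> c f)"

definition edge_chromatic_number :: "'a set set \<Rightarrow> nat" where
  "edge_chromatic_number E = (LEAST l. \<exists>c. proper_edge_coloring E l c)"

definition two_simultaneous_edge_coloring ::
    "'a set \<Rightarrow> 'a set set \<Rightarrow> nat \<Rightarrow> ('a set \<Rightarrow> nat) \<Rightarrow> ('a set \<Rightarrow> nat) \<Rightarrow> bool" where
  "two_simultaneous_edge_coloring V E l c1 c2 \<longleftrightarrow>
     proper_edge_coloring E l c1 \<and> proper_edge_coloring E l c2 \<and>
     (\<forall>v\<in>V. c1 ` {e\<in>E. v \<in> e} = c2 ` {e\<in>E. v \<in> e}) \<and>
     (\<forall>e\<in>E. c1 e \<noteq> c2 e)"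

definition two_simultaneous_edge_colorable :: "'a set \<Rightarrow> 'a set set \<Rightarrow> bool" where
  "two_simultaneous_edge_colorable V E \<longleftrightarrow>
     (\<exists>l c1 c2. two_simultaneous_edge_coloring V E l c1 c2)"

end

theory Submission
  imports Defs "HOL-Library.Disjoint_Sets"
begin

text \<open>For a color \<open>i\<close>, the edges colored \<open>i\<close> by \<open>c1\<close> and those colored \<open>i\<close> by \<open>c2\<close> are disjoint
  matchings covering the same vertices, so their union is a disjoint union of alternating
  cycles.  These have even length, hence length at least \<open>2 k\<close> by the girth condition, and so
  every color used by \<open>c1\<close> occurs on at least \<open>k\<close> edges.  Summing over the used colors, of which
  there are at least \<open>edge_chromatic_number E\<close>, gives the bound.\<close>

text \<open>Finiteness of \<open>S\<close> makes the walk that starts at \<open>x\<close> and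
  applies \<open>f\<close> and \<open>g\<close> in turn repeat a value. Both maps are involutions,
  so the walk can be retraced. Hence repetitions occur only at even distances, and the first
  positive even time of return to the start is \<open>2 * d\<close>.\<close>

lemma alternating_walk_cycle:
  fixes f g :: "'a \<Rightarrow> 'a"
  assumes "finite S" "x \<in> S"
    and f: "\<And>y. y \<in> S \<Longrightarrow> f y \<in> S \<and> f (f y) = y \<and> f y \<noteq> y"
    and g: "\<And>y. y \<in> S \<Longrightarrow> g y \<in> S \<and> g (g y) = y \<and> g y \<noteq> y"
    and fg: "\<And>y. y \<in> S \<Longrightarrow> f y \<noteq> g y"
  obtains w :: "nat \<Rightarrow> 'a" and d where
    "\<forall>n. w n \<in> S" "\<forall>n. w (Suc n) = (if even n then f else g) (w n)"
    "d \<ge> 2" "w (2 * d) = w 0" "inj_on w {..<2 * d}"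
proof -
  define s where "s n = (if even n then f else g)" for n :: nat
  define w where "w = rec_nat x (\<lambda>n y. s n y)"
  have w_Suc: "w (Suc n) = s n (w n)" for n by (simp add: w_def)
  have s: "s n y \<in> S \<and> s n (s n y) = y \<and> s n y \<noteq> y" if "y \<in> S" for n y
    using f[OF that] g[OF that] by (simp add: s_def)
  have s_cong: "s m = s n" if "even m = even n" for m n
    using that by (simp add: s_def)
  have w_S: "w n \<in> S" for n
    by (induction n) (use assms(2) s in \<open>auto simp: w_def\<close>)
  have step_back: "s n (w (Suc n)) = w n" for n
    using s[OF w_S] by (simp add: w_Suc)
  \<comment> \<open>An odd gap can be shrunk from both ends, until a fixed point of \<open>f\<close> or \<open>g\<close> arises.\<close>
  have odd_gap: "w a \<noteq> w (a + 2 * n + 1)" for a n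
  proof (induction n arbitrary: a)
    case 0
    then show ?case using s[OF w_S] by (metis add_0_right mult_0_right Suc_eq_plus1 w_Suc)
  next
    case (Suc n)
    show ?case
    proof
      assume eq: "w a = w (a + 2 * Suc n + 1)"
      have "w (Suc a) = s a (w a)" by (rule w_Suc)
      also have "\<dots> = s a (w (Suc (a + 2 * n + 2)))" using eq by simp
      also have "s a = s (a + 2 * n + 2)" by (rule s_cong) simp
      also have "s (a + 2 * n + 2) (w (Suc (a + 2 * n + 2))) = w (a + 2 * n + 2)"
        by (rule step_back)
      finally show False using Suc.IH[of "Suc a"] by simp
    qed
  qed
  \<comment> \<open>Positions at an even distance are reached by the same involution, so undoing it
    at both moves the repetition back by one, down to the start.\<close>
  have even_gap: "w 0 = w (2 * n)" if "w a = w (a + 2 * n)" for a n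
    using that
  proof (induction a)
    case (Suc a)
    have "w a = s a (w (Suc (a + 2 * n)))" using Suc.prems step_back[of a] by simp
    also have "s a = s (a + 2 * n)" by (rule s_cong) simp
    finally show ?case using Suc.IH step_back by simp
  qed simp
  have "\<not> inj w"
    using finite_subset[OF _ assms(1), of "range w"] w_S
    by (meson finite_imageD image_subsetI infinite_UNIV_nat)
  then obtain a b where "a < b" "w a = w b"
    by (metis injI nat_neq_iff)
  then have "\<exists>n>0. w (2 * n) = w 0"
  proof (cases "even (b - a)")
    case True
    then obtain n where "b = a + 2 * n" using \<open>a < b\<close>
      by (metis evenE le_add_diff_inverse less_imp_le)
    then show ?thesis using \<open>a < b\<close> \<open>w a = w b\<close> even_gap[of a n] by auto
  next
    case False
    then obtain n where "b = a + 2 * n + 1" using \<open>a < b\<close>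
      by (metis oddE le_add_diff_inverse less_imp_le add.assoc)
    then show ?thesis using \<open>w a = w b\<close> odd_gap by simp
  qed
  then obtain d where d: "d > 0" "w (2 * d) = w 0"
    and least: "\<And>n. \<lbrakk>0 < n; n < d\<rbrakk> \<Longrightarrow> w (2 * n) \<noteq> w 0"
    using exists_least_iff[of "\<lambda>n. 0 < n \<and> w (2 * n) = w 0"] by blast
  \<comment> \<open>A return after two steps would give \<open>f (w 0) = g (w 0)\<close>, because
    \<open>g\<close> is an involution.\<close>
  have "w 2 \<noteq> w 0"
  proof
    assume "w 2 = w 0"
    then have "g (f (w 0)) = w 0" by (simp add: w_Suc s_def numeral_2_eq_2)
    then show False using f g fg w_S by metis
  qed
  with d have "d \<ge> 2" by (cases "d = 1") auto
  \<comment> \<open>An even gap \<open>2 * n\<close> here would be a return to the start with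
    \<open>0 < n < d\<close>, against the minimality of \<open>d\<close>.\<close>
  have "w a \<noteq> w b" if "a < b" "b < 2 * d" for a b
  proof
    assume eq: "w a = w b"
    show False
    proof (cases "even (b - a)")
      case True
      then obtain n where "b = a + 2 * n" using \<open>a < b\<close>
        by (metis evenE le_add_diff_inverse less_imp_le)
      then show False using eq even_gap[of a n] least[of n] that by auto
    next
      case False
      then obtain n where "b = a + 2 * n + 1" using \<open>a < b\<close>
        by (metis oddE le_add_diff_inverse less_imp_le add.assoc)
      then show False using eq odd_gap by simp
    qed
  qed
  then have "inj_on w {..<2 * d}"
    by (intro inj_onI) (metis lessThan_iff nat_neq_iff)
  then show thesis using that[of w d] w_S w_Suc \<open>d \<ge> 2\<close> d(2) by (simp add: s_def)
qed

text \<open>Encodes a matching as the involution exchanging the two ends of each edge, the form that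
  the alternating walk takes as input.\<close>

lemma matching_partner:
  assumes "disjoint M" and "\<And>e. e \<in> M \<Longrightarrow> card e = 2"
  obtains f where "\<And>x. x \<in> \<Union>M \<Longrightarrow> {x, f x} \<in> M \<and> f x \<in> \<Union>M \<and> f (f x) = x \<and> f x \<noteq> x"
proof -
  have "\<exists>y. {x, y} \<in> M \<and> y \<noteq> x" if "x \<in> \<Union>M" for x
  proof -
    from that obtain e where e: "e \<in> M" "x \<in> e" by blast
    then obtain u v where "e = {u, v}" "u \<noteq> v" using assms(2) by (meson card_2_iff)
    with e show ?thesis by (auto simp: insert_commute)
  qed
  then obtain f where f: "\<And>x. x \<in> \<Union>M \<Longrightarrow> {x, f x} \<in> M \<and> f x \<noteq> x" by metis
  show thesis
  proof (rule that)
    fix x assume x: "x \<in> \<Union>M"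
    then have y: "f x \<in> \<Union>M" using f by blast
    have "{x, f x} = {f x, f (f x)}"
      using disjointD[OF assms(1), of "{x, f x}" "{f x, f (f x)}"] f[OF x] f[OF y] by blast
    then show "{x, f x} \<in> M \<and> f x \<in> \<Union>M \<and> f (f x) = x \<and> f x \<noteq> x"
      using f[OF x] f[OF y] y by (auto simp: doubleton_eq_iff)
  qed
qed

text \<open>The walk alternates between \<open>M\<close>-partners and \<open>N\<close>-partners,
  which differ because \<open>M\<close> and \<open>N\<close> share no edge. Its steps from even
  positions are \<open>d\<close> distinct edges of \<open>M\<close>, and its length is
  \<open>2 * d\<close>.\<close>

lemma cycle_in_union_of_matchings:
  assumes "finite (\<Union>M)" "M \<noteq> {}" "disjoint M" "disjoint N" "M \<inter> N = {}" "\<Union>M = \<Union>N"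
    and card2: "\<And>e. e \<in> M \<union> N \<Longrightarrow> card e = 2"
  obtains p where "is_cycle (M \<union> N) p" "length p \<le> 2 * card M"
proof -
  obtain f where f: "\<And>x. x \<in> \<Union>M \<Longrightarrow> {x, f x} \<in> M \<and> f x \<in> \<Union>M \<and> f (f x) = x \<and> f x \<noteq> x"
    using matching_partner[OF assms(3)] card2 by blast
  obtain g where g: "\<And>x. x \<in> \<Union>M \<Longrightarrow> {x, g x} \<in> N \<and> g x \<in> \<Union>M \<and> g (g x) = x \<and> g x \<noteq> x"
    using matching_partner[OF assms(4)] card2 unfolding assms(6) by blast
  have fg: "f x \<noteq> g x" if "x \<in> \<Union>M" for x
    using f[OF that] g[OF that] assms(5) by auto
  obtain e where "e \<in> M" using assms(2) by blast
  moreover have "e \<noteq> {}" using card2[of e] \<open>e \<in> M\<close> by auto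
  ultimately obtain x where x: "x \<in> \<Union>M" by blast
  have partners: "f y \<in> \<Union>M \<and> f (f y) = y \<and> f y \<noteq> y" "g y \<in> \<Union>M \<and> g (g y) = y \<and> g y \<noteq> y"
    if "y \<in> \<Union>M" for y
    using f[OF that] g[OF that] by simp_all
  obtain w d where w_S: "\<forall>n. w n \<in> \<Union>M"
    and w_Suc: "\<forall>n. w (Suc n) = (if even n then f else g) (w n)"
    and d: "d \<ge> 2" "w (2 * d) = w 0" and inj: "inj_on w {..<2 * d}"
    using alternating_walk_cycle[OF assms(1) x partners fg] by blast
  have edge: "{w n, w (Suc n)} \<in> (if even n then M else N)" for n
    using f g w_S by (simp add: w_Suc)
  have "is_cycle (M \<union> N) (map w [0..<2 * d])"
    unfolding is_cycle_def
  proof (intro conjI allI impI)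
    show "3 \<le> length (map w [0..<2 * d])" using d by simp
    show "distinct (map w [0..<2 * d])"
      using inj by (simp add: distinct_map atLeast0LessThan)
    fix i assume "i < length (map w [0..<2 * d])"
    then have i: "i < 2 * d" by simp
    \<comment> \<open>The closing edge is the case \<open>Suc i = 2 * d\<close>, where the index
      wraps to 0 and \<open>w (2 * d) = w 0\<close>.\<close>
    have "w (Suc i mod (2 * d)) = w (Suc i)"
      using i d by (cases "Suc i = 2 * d") auto
    then show "{map w [0..<2 * d] ! i,
        map w [0..<2 * d] ! (Suc i mod length (map w [0..<2 * d]))} \<in> M \<union> N"
      using i edge[of i] d by (auto split: if_splits)
  qed
  moreover have "d \<le> card M"
  proof -
    have "inj_on (\<lambda>i. {w (2 * i), w (Suc (2 * i))}) {..<d}"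
    proof (rule inj_onI)
      fix i j assume "i \<in> {..<d}" "j \<in> {..<d}"
        and eq: "{w (2 * i), w (Suc (2 * i))} = {w (2 * j), w (Suc (2 * j))}"
      then have "2 * i < 2 * d" "2 * j < 2 * d" "Suc (2 * j) < 2 * d" by auto
      \<comment> \<open>Only the end \<open>w (2 * i)\<close> has to be located: injectivity of
        \<open>w\<close> turns the equations into equations of indices, and parity rules out the
        second.\<close>
      moreover from eq have "w (2 * i) = w (2 * j) \<or> w (2 * i) = w (Suc (2 * j))"
        by (auto simp: doubleton_eq_iff)
      ultimately have "2 * i = 2 * j \<or> 2 * i = Suc (2 * j)"
        using inj by (auto dest: inj_onD)
      then show "i = j" by presburger
    qed
    moreover have "(\<lambda>i. {w (2 * i), w (Suc (2 * i))}) ` {..<d} \<subseteq> M"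
      using edge by (metis (no_types, lifting) dvd_triv_left image_subsetI)
    moreover have "finite M" using assms(1) by (rule finite_UnionD)
    ultimately show ?thesis using card_inj_on_le by fastforce
  qed
  ultimately show thesis using that by simp
qed

text \<open>The palette \<open>{1..l}\<close> may contain colors that no edge has; renumbering the
  used ones consecutively keeps the coloring proper.\<close>

lemma edge_chromatic_number_le_card_image:
  assumes "finite E" "proper_edge_coloring E l c"
  shows "edge_chromatic_number E \<le> card (c ` E)"
proof -
  obtain h where h: "bij_betw h (c ` E) {1..card (c ` E)}"
    using finite_same_card_bij[of "c ` E" "{1..card (c ` E)}"] assms(1) by auto
  have "proper_edge_coloring E (card (c ` E)) (h \<circ> c)"
    unfolding proper_edge_coloring_def
  proof (intro conjI ballI impI)
    show "(h \<circ> c) ` E \<subseteq> {1..card (c ` E)}"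
      using h by (simp add: bij_betw_def image_comp)
    fix e f assume "e \<in> E" "f \<in> E" "e \<noteq> f \<and> e \<inter> f \<noteq> {}"
    then have "c e \<noteq> c f" using assms(2) unfolding proper_edge_coloring_def by blast
    then show "(h \<circ> c) e \<noteq> (h \<circ> c) f"
      using h \<open>e \<in> E\<close> \<open>f \<in> E\<close> by (auto simp: bij_betw_def inj_on_eq_iff)
  qed
  then show ?thesis unfolding edge_chromatic_number_def by (auto intro: Least_le)
qed

lemma disjoint_color_class:
  assumes "proper_edge_coloring E l c"
  shows "disjoint {e \<in> E. c e = i}"
proof (rule disjointI)
  fix e f assume "e \<in> {e \<in> E. c e = i}" "f \<in> {e \<in> E. c e = i}" "e \<noteq> f"
  then show "e \<inter> f = {}" using assms unfolding proper_edge_coloring_def by blast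
qed

text \<open>Equal color sets at each vertex make the two classes of color \<open>i\<close> cover the
  same vertices, and \<open>c1 e \<noteq> c2 e\<close> makes them disjoint, so their union contains
  a short cycle.\<close>

lemma girth_le_card_color_class:
  assumes "simple_graph V E" "two_simultaneous_edge_coloring V E l c1 c2" "i \<in> c1 ` E"
  shows "girth E \<le> enat (2 * card {e \<in> E. c1 e = i})"
proof -
  let ?M = "{e \<in> E. c1 e = i}" and ?N = "{e \<in> E. c2 e = i}"
  have sim: "c1 ` {e \<in> E. v \<in> e} = c2 ` {e \<in> E. v \<in> e}" if "v \<in> V" for v
    using assms(2) that unfolding two_simultaneous_edge_coloring_def by blast
  have E: "e \<subseteq> V" "card e = 2" if "e \<in> E" for e
    using assms(1) that unfolding simple_graph_def by auto
  have cover: "v \<in> \<Union>?M \<longleftrightarrow> v \<in> \<Union>?N" for v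
  proof (cases "v \<in> V")
    case True
    have "v \<in> \<Union>?M \<longleftrightarrow> i \<in> c1 ` {e \<in> E. v \<in> e}" by auto
    also have "\<dots> \<longleftrightarrow> v \<in> \<Union>?N" unfolding sim[OF True] by auto
    finally show ?thesis .
  next
    case False
    then show ?thesis using E(1) by blast
  qed
  have "finite (\<Union>?M)"
    using assms(1) E(1) unfolding simple_graph_def by (auto intro: finite_subset[of _ V])
  moreover have "?M \<noteq> {}" using assms(3) by auto
  moreover have "disjoint ?M" "disjoint ?N"
    using assms(2) unfolding two_simultaneous_edge_coloring_def
    by (auto intro: disjoint_color_class)
  moreover have "?M \<inter> ?N = {}"
    using assms(2) unfolding two_simultaneous_edge_coloring_def by auto
  moreover have "\<Union>?M = \<Union>?N" using cover by (rule set_eqI)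
  moreover have "card e = 2" if "e \<in> ?M \<union> ?N" for e using that E(2) by blast
  ultimately obtain p where p: "is_cycle (?M \<union> ?N) p" "length p \<le> 2 * card ?M"
    by (rule cycle_in_union_of_matchings)
  then have "is_cycle E p" unfolding is_cycle_def by blast
  then have "girth E \<le> enat (length p)" unfolding girth_def by (auto intro: Inf_lower)
  with p(2) show ?thesis by (meson enat_ord_simps(1) order_trans)
qed

theorem theorem3p3:
  fixes V :: "'a set" and E :: "'a set set" and k :: nat
  assumes "k \<ge> 2"
    and "simple_graph V E"
    and "bridgeless V E"
    and "girth E \<ge> enat (2 * k - 1)"
    and "two_simultaneous_edge_colorable V E"
  shows "card E \<ge> k * edge_chromatic_number E"
proof -
  obtain l c1 c2 where c: "two_simultaneous_edge_coloring V E l c1 c2"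
    using assms(5) unfolding two_simultaneous_edge_colorable_def by blast
  have "E \<subseteq> Pow V" "finite V" using assms(2) unfolding simple_graph_def by auto
  then have "finite E" by (meson finite_Pow_iff finite_subset)
  have size_class: "k \<le> card {e \<in> E. c1 e = i}" if "i \<in> c1 ` E" for i
  proof -
    have "enat (2 * k - 1) \<le> enat (2 * card {e \<in> E. c1 e = i})"
      using assms(4) girth_le_card_color_class[OF assms(2) c that] by (rule order_trans)
    \<comment> \<open>The right side is even, so the odd lower bound \<open>2 * k - 1\<close>
      improves to \<open>2 * k\<close>.\<close>
    then show ?thesis by simp
  qed
  have "edge_chromatic_number E \<le> card (c1 ` E)"
    using c \<open>finite E\<close> edge_chromatic_number_le_card_image
    unfolding two_simultaneous_edge_coloring_def by blast
  then have "k * edge_chromatic_number E \<le> (\<Sum>i\<in>c1 ` E. k)" by simp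
  also have "\<dots> \<le> (\<Sum>i\<in>c1 ` E. card {e \<in> E. c1 e = i})"
    using size_class by (rule sum_mono)
  \<comment> \<open>The fibers of \<open>c1\<close> partition \<open>E\<close>; counting edges is
    summing the constant 1 over them.\<close>
  also have "\<dots> = card E"
    using sum.image_gen[OF \<open>finite E\<close>, of "\<lambda>_. 1 :: nat" c1] by simp
  finally show ?thesis .
qed

end
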